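(* Let $q>0$ be an integer, and let $K(t,r)$ denote the heat kernel $K(t,x_0,x)$ of the $(q+1)$-regular tree, which depends only on $t\ge 0$ and the radial coordinate $r=d(x_0,x)$. Then for all integers $r\ge0$ and all $t\ge 0$, $$K(t,r)=q^{-r/2}e^{-(q+1)t}I_r(2\sqrt{q}\,t)-(q-1)\sum_{j=1}^\infty q^{-(r+2j)/2}e^{-(q+1)t}I_{r+2j}(2\sqrt{q}\,t),$$ where $I$ denotes the $I$-Bessel function.
   Context: The $(q+1)$-regular tree is the connected graph without circuits in which every vertex has exactly $q+1$ neighbours; $x_0$ is a fixed base vertex and $d$ is the combinatorial distance. The Laplacian on functions $f$ on the vertices is $\Delta f(x)=(q+1)f(x)-\sum_{y\sim x} f(y)$, the sum being over neighbours of $x$. The heat kernel $K(t,x_0,x)$, $t\ge 0$, is the unique bounded solution of $\Delta K(t,x_0,x)+\frac{\partial}{\partial t}K(t,x_0,x)=0$ (with $\Delta$ acting in $x$), $K(0,x_0,x)=1$ if $x=x_0$ and $0$ otherwise. It is invariant under automorphisms of the tree, hence depends only on $d(x_0,x)$. For an integer $m\ge0$, $I_m(t)=\sum_{n=0}^\infty \frac{(t/2)^{2n+m}}{n!\,\Gamma(n+1+m)}$. *)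

theory Defs
  imports "HOL-Analysis.Analysis"
begin

definition neighbours :: "'a set \<Rightarrow> ('a \<Rightarrow> 'a \<Rightarrow> bool) \<Rightarrow> 'a \<Rightarrow> 'a set" where
  "neighbours V E x = {y \<in> V. E x y}"

definition circuit :: "('a \<Rightarrow> 'a \<Rightarrow> bool) \<Rightarrow> 'a list \<Rightarrow> bool" where
  "circuit E xs \<longleftrightarrow>
     3 \<le> length xs \<and> distinct xs \<and> successively E xs \<and> E (last xs) (hd xs)"

locale regular_tree =
  fixes V :: "'a set" and E :: "'a \<Rightarrow> 'a \<Rightarrow> bool" and q :: nat
  assumes adj_in_V: "E x y \<Longrightarrow> x \<in> V \<and> y \<in> V"
    and adj_sym: "E x y \<Longrightarrow> E y x"
    and adj_irrefl: "\<not> E x x"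
    and nonempty: "V \<noteq> {}"
    and connected: "x \<in> V \<Longrightarrow> y \<in> V \<Longrightarrow> E\<^sup>*\<^sup>* x y"
    and no_circuit: "\<not> circuit E xs"
    and regular: "x \<in> V \<Longrightarrow> card (neighbours V E x) = q + 1"

text \<open>The power \<open>E ^^ n\<close> relates the end points of the walks with \<open>n\<close> edges.\<close>

definition graph_dist :: "('a \<Rightarrow> 'a \<Rightarrow> bool) \<Rightarrow> 'a \<Rightarrow> 'a \<Rightarrow> nat" where
  "graph_dist E x y = (LEAST n. (E ^^ n) x y)"

definition laplacian ::
  "'a set \<Rightarrow> ('a \<Rightarrow> 'a \<Rightarrow> bool) \<Rightarrow> nat \<Rightarrow> ('a \<Rightarrow> real) \<Rightarrow> 'a \<Rightarrow> real" where
  "laplacian V E q f x = (real q + 1) * f x - (\<Sum>y\<in>neighbours V E x. f y)"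

text \<open>At \<open>t = 0\<close> the time derivative is the right derivative.\<close>

definition bounded_heat_solution ::
  "'a set \<Rightarrow> ('a \<Rightarrow> 'a \<Rightarrow> bool) \<Rightarrow> nat \<Rightarrow> 'a \<Rightarrow> (real \<Rightarrow> 'a \<Rightarrow> real) \<Rightarrow> bool" where
  "bounded_heat_solution V E q x0 K \<longleftrightarrow>
     (\<exists>C. \<forall>t\<ge>0. \<forall>x\<in>V. \<bar>K t x\<bar> \<le> C) \<and>
     (\<forall>t\<ge>0. \<forall>x\<in>V. \<exists>D. ((\<lambda>s. K s x) has_real_derivative D) (at t within {0..}) \<and>
        laplacian V E q (K t) x + D = 0) \<and>
     (\<forall>x\<in>V. K 0 x = (if x = x0 then 1 else 0))"

text \<open>
  The heat kernel is a function on \<open>{0..} \<times> V\<close>; outside this domain it is set to \<open>0\<close>, so that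
  the description determines a unique function on the types.
\<close>

definition heat_kernel ::
  "'a set \<Rightarrow> ('a \<Rightarrow> 'a \<Rightarrow> bool) \<Rightarrow> nat \<Rightarrow> 'a \<Rightarrow> real \<Rightarrow> 'a \<Rightarrow> real" where
  "heat_kernel V E q x0 =
     (THE K. bounded_heat_solution V E q x0 K \<and> (\<forall>t x. t < 0 \<or> x \<notin> V \<longrightarrow> K t x = 0))"

definition bessel_I :: "nat \<Rightarrow> real \<Rightarrow> real" where
  "bessel_I m t = (\<Sum>n. (t / 2) ^ (2 * n + m) / (fact n * Gamma (real (n + 1 + m))))"

end

theory Submission
  imports Defs
begin

text \<open>
  Write \<open>\<Delta> = (q + 1) - A\<close> with the adjacency operator \<open>A\<close>. The heat kernel should then be
  \<open>e\<^sup>-\<^sup>(\<^sup>q\<^sup>+\<^sup>1\<^sup>)\<^sup>t \<Sum>\<^sub>n W\<^sub>n(r) t\<^sup>n / n!\<close>, where \<open>W\<^sub>n(r)\<close> is the number of walks of length \<open>n\<close> between two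
  vertices at distance \<open>r\<close>. A vertex at distance \<open>r + 1\<close> from the base has one neighbour at
  distance \<open>r\<close> and \<open>q\<close> neighbours at distance \<open>r + 2\<close>, which gives a recursion for \<open>W\<^sub>n\<close> and makes
  the series a solution of the heat equation (\<open>bounded_heat_solution_walk_series\<close>). The estimate
  \<open>0 \<le> W\<^sub>n(r) \<le> (q + 1)\<^sup>n\<close> makes it bounded, so it is the heat kernel, because the Laplacian is a
  bounded operator on bounded functions and Picard iteration forces uniqueness
  (\<open>bounded_zero_initial_imp_zero\<close>).

  The Bessel function comes from walks on the integer line. Give each upward
  step the weight \<open>q\<close>; the walks of length \<open>2 k + r\<close> from \<open>r\<close> to \<open>0\<close> then have total
  weight \<open>(2 k + r choose k) q\<^sup>k\<close>, and their exponential generating function is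
  \<open>q\<^sup>-\<^sup>r\<^sup>/\<^sup>2 I\<^sub>r(2 \<surd>q t)\<close>. Tree and line are compared through the walks that never go below \<open>0\<close>.
  With \<open>L\<^sub>n(r)\<close> for the weight on the line, both \<open>W\<^sub>n(r) - W\<^sub>n(r + 2)\<close> and \<open>L\<^sub>n(r) - q L\<^sub>n(r + 2)\<close> are
  the total weight of these (\<open>tree_walks_diff\<close>). Summing this identity over \<open>r, r + 2, r + 4, \<dots>\<close>
  telescopes on the tree side and yields the stated Bessel series, in which every term after the
  first has coefficient \<open>1 - q\<close>.
\<close>

section \<open>The exponential series\<close>

lemma summable_exp_real: "summable (\<lambda>n. x ^ n / fact n :: real)"
  using summable_exp[of x] by (simp add: field_simps)

lemma suminf_exp_real: "(\<Sum>n. x ^ n / fact n) = exp (x :: real)"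
  by (simp add: exp_def field_simps)

section \<open>Distance spheres in the regular tree\<close>

context regular_tree
begin

lemma finite_neighbours: "x \<in> V \<Longrightarrow> finite (neighbours V E x)"
  using regular[of x] by (metis card.infinite add_is_0 one_neq_zero)

lemma relpowp_graph_dist:
  assumes "x \<in> V" "y \<in> V"
  shows "(E ^^ graph_dist E x y) x y"
proof -
  obtain n where "(E ^^ n) x y"
    using connected[OF assms] rtranclp_imp_relpowp by metis
  then show ?thesis
    unfolding graph_dist_def by (rule LeastI)
qed

lemma graph_dist_le: "(E ^^ n) x y \<Longrightarrow> graph_dist E x y \<le> n"
  unfolding graph_dist_def by (rule Least_le)

lemma graph_dist_eq_0_iff:
  assumes "x \<in> V" "y \<in> V"
  shows "graph_dist E x y = 0 \<longleftrightarrow> x = y"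
proof
  assume "graph_dist E x y = 0"
  with relpowp_graph_dist[OF assms] show "x = y" by simp
next
  assume "x = y"
  then have "(E ^^ 0) x y" by simp
  from graph_dist_le[OF this] show "graph_dist E x y = 0" by simp
qed

lemma graph_dist_step:
  assumes "x0 \<in> V" "E x y"
  shows "graph_dist E x0 y \<le> Suc (graph_dist E x0 x)"
proof -
  have "(E ^^ graph_dist E x0 x) x0 x"
    using assms adj_in_V relpowp_graph_dist by blast
  then have "(E ^^ Suc (graph_dist E x0 x)) x0 y"
    using assms(2) by (rule relpowp_Suc_I)
  then show ?thesis by (rule graph_dist_le)
qed

lemma predecessor_exists:
  assumes "x0 \<in> V" "x \<in> V" "graph_dist E x0 x = Suc n"
  obtains y where "E y x" "graph_dist E x0 y = n"
proof -
  have "(E ^^ Suc n) x0 x"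
    using relpowp_graph_dist[OF assms(1,2)] assms(3) by simp
  then obtain y where y: "(E ^^ n) x0 y" "E y x"
    by (rule relpowp_Suc_E)
  have "graph_dist E x0 y \<le> n" using y(1) by (rule graph_dist_le)
  moreover have "Suc n \<le> Suc (graph_dist E x0 y)"
    using graph_dist_step[OF assms(1) y(2)] assms(3) by simp
  ultimately have "graph_dist E x0 y = n" by simp
  with y(2) show ?thesis by (rule that)
qed

text \<open>
  Descend from both vertices towards the base vertex until the two descents meet. Keeping the
  interior strictly below the level of the end points is what makes the path simple, and what
  leaves room to close it up from the same level or from the level above.
\<close>

lemma path_through_lower_levels:
  assumes "x0 \<in> V" "y \<in> V" "z \<in> V" "y \<noteq> z"
    and "graph_dist E x0 y = n" "graph_dist E x0 z = n"
  shows "\<exists>p. p \<noteq> [] \<and> successively E (y # p @ [z]) \<and> distinct p \<and>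
             (\<forall>v\<in>set p. graph_dist E x0 v < n)"
  using assms(2-)
proof (induction n arbitrary: y z)
  case 0
  then show ?case using graph_dist_eq_0_iff[OF assms(1)] by auto
next
  case (Suc n)
  obtain y' where y': "E y' y" "graph_dist E x0 y' = n"
    using predecessor_exists[OF assms(1) Suc.prems(1,4)] by blast
  obtain z' where z': "E z' z" "graph_dist E x0 z' = n"
    using predecessor_exists[OF assms(1) Suc.prems(2,5)] by blast
  have E: "E y y'" using y'(1) by (rule adj_sym)
  show ?case
  proof (cases "y' = z'")
    case True
    then have "successively E (y # [y'] @ [z])" using E z'(1) by simp
    then show ?thesis
      using y'(2) by (intro exI[of _ "[y']"]) simp
  next
    case False
    have "y' \<in> V" "z' \<in> V" using y'(1) z'(1) adj_in_V by blast+
    then obtain p where p: "p \<noteq> []" "successively E (y' # p @ [z'])" "distinct p"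
        "\<forall>v\<in>set p. graph_dist E x0 v < n"
      using Suc.IH[OF _ _ False y'(2) z'(2)] by blast
    define p' where "p' = y' # p @ [z']"
    have "successively E (y # p' @ [z])"
      using p(2) E z'(1)
      by (auto simp: p'_def successively_append_iff successively_Cons hd_append)
    moreover have "distinct p'"
      using p(3,4) False y'(2) z'(2) by (auto simp: p'_def)
    moreover have "\<forall>v\<in>set p'. graph_dist E x0 v < Suc n"
      using p(4) y'(2) z'(2) by (auto simp: p'_def)
    moreover have "p' \<noteq> []" by (simp add: p'_def)
    ultimately show ?thesis by blast
  qed
qed

text \<open>
  An edge inside a level closes the path between its end points to a circuit.
\<close>

lemma adjacent_imp_graph_dist_neq:
  assumes "x0 \<in> V" "E y z"
  shows "graph_dist E x0 y \<noteq> graph_dist E x0 z"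
proof
  assume eq: "graph_dist E x0 y = graph_dist E x0 z"
  have "y \<noteq> z" using assms(2) adj_irrefl by blast
  moreover have "y \<in> V" "z \<in> V" using assms(2) adj_in_V by blast+
  ultimately obtain p where p: "p \<noteq> []" "successively E (y # p @ [z])" "distinct p"
      "\<forall>v\<in>set p. graph_dist E x0 v < graph_dist E x0 z"
    using path_through_lower_levels[OF assms(1) _ _ _ eq refl] by blast
  have "3 \<le> length (y # p @ [z])" using p(1) by (cases p) auto
  moreover have "distinct (y # p @ [z])" using p(3,4) eq \<open>y \<noteq> z\<close> by auto
  moreover have "E (last (y # p @ [z])) (hd (y # p @ [z]))"
    using adj_sym[OF assms(2)] by simp
  ultimately have "circuit E (y # p @ [z])" using p(2) by (simp only: circuit_def)
  then show False using no_circuit by blast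
qed

text \<open>
  Two different predecessors of a vertex, joined through the levels below them, form a circuit
  with that vertex.
\<close>

lemma predecessor_unique:
  assumes "x0 \<in> V" "E y x" "E z x"
    and "graph_dist E x0 x = Suc n" "graph_dist E x0 y = n" "graph_dist E x0 z = n"
  shows "y = z"
proof (rule ccontr)
  assume "y \<noteq> z"
  have "y \<in> V" "z \<in> V" using assms(2,3) adj_in_V by blast+
  then obtain p where p: "p \<noteq> []" "successively E (y # p @ [z])" "distinct p"
      "\<forall>v\<in>set p. graph_dist E x0 v < n"
    using path_through_lower_levels[OF assms(1) _ _ \<open>y \<noteq> z\<close> assms(5,6)] by blast
  define c where "c = (y # p @ [z]) @ [x]"
  have "successively E c"
    using p(2) assms(3) by (auto simp: c_def successively_append_iff successively_Cons hd_append)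
  moreover have "distinct c"
    using p(3,4) \<open>y \<noteq> z\<close> assms(4-6) by (auto simp: c_def)
  moreover have "E (last c) (hd c)" using adj_sym[OF assms(2)] by (simp add: c_def)
  ultimately have "circuit E c" by (simp add: circuit_def c_def)
  then show False using no_circuit by blast
qed

text \<open>
  Together with the next lemma, this reduces the Laplacian of a radial function to a difference
  operator in the distance.
\<close>

lemma sum_neighbours_base:
  fixes f :: "nat \<Rightarrow> real"
  assumes "x0 \<in> V"
  shows "(\<Sum>y\<in>neighbours V E x0. f (graph_dist E x0 y)) = (real q + 1) * f 1"
proof -
  have "graph_dist E x0 y = 1" if "y \<in> neighbours V E x0" for y
  proof -
    have y: "E x0 y" "y \<in> V" using that by (auto simp: neighbours_def)
    have d0: "graph_dist E x0 x0 = 0" using graph_dist_eq_0_iff[OF assms assms] by simp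
    show ?thesis
      using graph_dist_step[OF assms y(1)] adjacent_imp_graph_dist_neq[OF assms y(1)] d0 by simp
  qed
  then show ?thesis by (simp add: regular[OF assms] algebra_simps)
qed

lemma sum_neighbours_Suc:
  fixes f :: "nat \<Rightarrow> real"
  assumes "x0 \<in> V" "x \<in> V" "graph_dist E x0 x = Suc n"
  shows "(\<Sum>y\<in>neighbours V E x. f (graph_dist E x0 y)) = f n + real q * f (n + 2)"
proof -
  obtain y0 where y0: "E y0 x" "graph_dist E x0 y0 = n"
    using predecessor_exists[OF assms] by blast
  let ?N = "neighbours V E x"
  have mem: "y0 \<in> ?N" using adj_sym[OF y0(1)] adj_in_V by (auto simp: neighbours_def)
  have dist: "graph_dist E x0 y = n + 2" if "y \<in> ?N - {y0}" for y
  proof -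
    have y: "E x y" "y \<noteq> y0" using that by (auto simp: neighbours_def)
    have "graph_dist E x0 y \<noteq> n"
      using predecessor_unique[OF assms(1) adj_sym[OF y(1)] y0(1) assms(3) _ y0(2)] y(2) by blast
    moreover have "graph_dist E x0 y \<noteq> Suc n"
      using adjacent_imp_graph_dist_neq[OF assms(1) y(1)] assms(3) by simp
    moreover have "graph_dist E x0 y \<le> n + 2"
      using graph_dist_step[OF assms(1) y(1)] assms(3) by simp
    moreover have "Suc n \<le> Suc (graph_dist E x0 y)"
      using graph_dist_step[OF assms(1) adj_sym[OF y(1)]] assms(3) by simp
    ultimately show ?thesis by linarith
  qed
  have "card (?N - {y0}) = q"
    using mem regular[OF assms(2)] by simp
  then have "(\<Sum>y\<in>?N - {y0}. f (graph_dist E x0 y)) = real q * f (n + 2)"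
    using dist by simp
  then show ?thesis
    using sum.remove[OF finite_neighbours[OF assms(2)] mem, of "\<lambda>y. f (graph_dist E x0 y)"] y0(2)
    by simp
qed

section \<open>Uniqueness of bounded solutions\<close>

lemma abs_laplacian_le:
  assumes "x \<in> V" "\<And>y. y \<in> V \<Longrightarrow> \<bar>f y\<bar> \<le> B"
  shows "\<bar>laplacian V E q f x\<bar> \<le> 2 * (real q + 1) * B"
proof -
  have "\<bar>\<Sum>y\<in>neighbours V E x. f y\<bar> \<le> (\<Sum>y\<in>neighbours V E x. \<bar>f y\<bar>)"
    by (rule sum_abs)
  also have "\<dots> \<le> real (card (neighbours V E x)) * B"
    by (rule sum_bounded_above) (auto simp: neighbours_def assms(2))
  finally have 1: "\<bar>\<Sum>y\<in>neighbours V E x. f y\<bar> \<le> (real q + 1) * B"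
    by (simp add: regular[OF assms(1)] algebra_simps)
  have "\<bar>(real q + 1) * f x\<bar> \<le> (real q + 1) * B"
    using assms by (simp add: abs_mult mult_left_mono)
  with 1 show ?thesis unfolding laplacian_def by (simp add: abs_le_iff algebra_simps)
qed

text \<open>
  Picard iteration: the Laplacian has norm at most \<open>M = 2 (q + 1)\<close> on bounded functions, so each
  integration of the equation improves the bound by a factor \<open>M t / (n + 1)\<close>.
\<close>

lemma bounded_zero_initial_imp_zero:
  assumes bound: "\<And>t x. t \<ge> 0 \<Longrightarrow> x \<in> V \<Longrightarrow> \<bar>u t x\<bar> \<le> C"
    and deriv: "\<And>t x. t \<ge> 0 \<Longrightarrow> x \<in> V \<Longrightarrow>
      ((\<lambda>s. u s x) has_real_derivative - laplacian V E q (u t) x) (at t within {0..})"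
    and init: "\<And>x. x \<in> V \<Longrightarrow> u 0 x = 0"
    and "t \<ge> 0" "x \<in> V"
  shows "u t x = 0"
proof -
  define M where "M = 2 * (real q + 1)"
  have picard: "\<bar>u t x\<bar> \<le> C * (M * t) ^ n / fact n" if "t \<ge> 0" "x \<in> V" for n t x
    using that
  proof (induction n arbitrary: t x)
    case 0
    then show ?case using bound by simp
  next
    case (Suc n)
    define P where "P s = C * (M * s) ^ Suc n / fact (Suc n)" for s
    have P: "(P has_real_derivative M * (C * (M * s) ^ n / fact n)) (at s)" for s
    proof -
      have "(P has_real_derivative
          C * (real (Suc n) * (M * s) ^ n * M) / fact (Suc n)) (at s)"
        unfolding P_def
        by (rule derivative_eq_intros refl | simp del: of_nat_Suc power_Suc fact_Suc)+
      then show ?thesis by (simp add: mult_ac del: of_nat_Suc)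
    qed
    have lap: "\<bar>laplacian V E q (u s) x\<bar> \<le> M * (C * (M * s) ^ n / fact n)" if "s \<ge> 0" for s
      unfolding M_def using Suc.IH[OF that] Suc.prems(2)
      by (intro abs_laplacian_le) (auto simp: M_def)
    have cont: "continuous_on {0..t} (\<lambda>s. u s x)"
    proof (rule continuous_on_subset)
      show "continuous_on {0..} (\<lambda>s. u s x)"
        using deriv[OF _ Suc.prems(2)] by (intro DERIV_continuous_on) auto
    qed auto
    have contP: "continuous_on {0..t} P"
      using P by (meson DERIV_continuous_on has_field_derivative_at_within)
    have deriv_at: "((\<lambda>s. u s x) has_real_derivative - laplacian V E q (u s) x) (at s)"
      if "0 < s" for s
      using deriv[of s x] that Suc.prems(2) at_within_interior[of s "{0..}"] by simp
    \<comment> \<open>The bound \<open>P\<close> grows at least as fast as \<open>u\<close> and \<open>-u\<close>, and all of them start at \<open>0\<close>.\<close>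
    have "P 0 - u 0 x \<le> P t - u t x"
    proof (rule DERIV_nonneg_imp_increasing_open[OF Suc.prems(1)])
      show "\<exists>D. ((\<lambda>s. P s - u s x) has_real_derivative D) (at s) \<and> D \<ge> 0"
        if "0 < s" "s < t" for s
        using DERIV_diff[OF P deriv_at[OF that(1)]] lap[of s] that(1) by fastforce
    qed (intro continuous_intros cont contP)
    moreover have "P 0 + u 0 x \<le> P t + u t x"
    proof (rule DERIV_nonneg_imp_increasing_open[OF Suc.prems(1)])
      show "\<exists>D. ((\<lambda>s. P s + u s x) has_real_derivative D) (at s) \<and> D \<ge> 0"
        if "0 < s" "s < t" for s
        using DERIV_add[OF P deriv_at[OF that(1)]] lap[of s] that(1) by fastforce
    qed (intro continuous_intros cont contP)
    ultimately show ?case using init[OF Suc.prems(2)] by (simp add: P_def abs_le_iff)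
  qed
  have "(\<lambda>n. C * ((M * t) ^ n / fact n)) \<longlonglongrightarrow> C * 0"
    by (intro tendsto_intros summable_LIMSEQ_zero summable_exp_real)
  then have "\<bar>u t x\<bar> \<le> C * 0"
    by (rule tendsto_lowerbound) (auto intro!: always_eventually picard[OF assms(4,5), simplified])
  then show ?thesis by simp
qed

lemma bounded_heat_solution_unique:
  assumes K: "bounded_heat_solution V E q x0 K" and L: "bounded_heat_solution V E q x0 L"
    and "t \<ge> 0" "x \<in> V"
  shows "K t x = L t x"
proof -
  obtain B where B: "\<And>t x. t \<ge> 0 \<Longrightarrow> x \<in> V \<Longrightarrow> \<bar>K t x\<bar> \<le> B"
    using K unfolding bounded_heat_solution_def by blast
  obtain C where C: "\<And>t x. t \<ge> 0 \<Longrightarrow> x \<in> V \<Longrightarrow> \<bar>L t x\<bar> \<le> C"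
    using L unfolding bounded_heat_solution_def by blast
  have dK: "((\<lambda>s. K s x) has_real_derivative - laplacian V E q (K t) x) (at t within {0..})"
    if "t \<ge> 0" "x \<in> V" for t x
    using K that unfolding bounded_heat_solution_def by (metis add_eq_0_iff)
  have dL: "((\<lambda>s. L s x) has_real_derivative - laplacian V E q (L t) x) (at t within {0..})"
    if "t \<ge> 0" "x \<in> V" for t x
    using L that unfolding bounded_heat_solution_def by (metis add_eq_0_iff)
  have "(\<lambda>t x. K t x - L t x) t x = 0"
  proof (rule bounded_zero_initial_imp_zero[OF _ _ _ assms(3,4)])
    show "\<bar>K t x - L t x\<bar> \<le> B + C" if "t \<ge> 0" "x \<in> V" for t x
      using B[OF that] C[OF that] by linarith
    show "((\<lambda>s. K s x - L s x) has_real_derivative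
            - laplacian V E q (\<lambda>x. K t x - L t x) x) (at t within {0..})"
      if "t \<ge> 0" "x \<in> V" for t x
      using DERIV_diff[OF dK[OF that] dL[OF that]]
      by (simp add: laplacian_def sum_subtractf algebra_simps)
    show "K 0 x - L 0 x = 0" if "x \<in> V" for x
      using K L that unfolding bounded_heat_solution_def by simp
  qed
  then show ?thesis by simp
qed

lemma heat_kernel_eqI:
  assumes K: "bounded_heat_solution V E q x0 K" and "t \<ge> 0" "x \<in> V"
  shows "heat_kernel V E q x0 t x = K t x"
proof -
  \<comment> \<open>Normalized outside the domain, as the definite description demands.\<close>
  define K' where "K' = (\<lambda>t x. if t < 0 \<or> x \<notin> V then 0 else K t x)"
  have lap: "laplacian V E q (K' t) x = laplacian V E q (K t) x" if "t \<ge> 0" "x \<in> V" for t x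
    using that by (auto simp: laplacian_def K'_def neighbours_def intro!: sum.cong)
  have der: "((\<lambda>s. K' s x) has_real_derivative D) (at t within {0..})"
    if "((\<lambda>s. K s x) has_real_derivative D) (at t within {0..})" "t \<ge> 0" "x \<in> V" for t x D
    using that(1) zero_less_one
    by (rule has_field_derivative_transform_within) (use that in \<open>auto simp: K'_def\<close>)
  have sol: "bounded_heat_solution V E q x0 K'"
    unfolding bounded_heat_solution_def
  proof (intro conjI)
    show "\<exists>C. \<forall>t\<ge>0. \<forall>x\<in>V. \<bar>K' t x\<bar> \<le> C"
      using K unfolding bounded_heat_solution_def by (simp add: K'_def)
    show "\<forall>t\<ge>0. \<forall>x\<in>V. \<exists>D. ((\<lambda>s. K' s x) has_real_derivative D) (at t within {0..}) \<and>
        laplacian V E q (K' t) x + D = 0"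
      using K der lap unfolding bounded_heat_solution_def by metis
    show "\<forall>x\<in>V. K' 0 x = (if x = x0 then 1 else 0)"
      using K unfolding bounded_heat_solution_def by (simp add: K'_def)
  qed
  have "heat_kernel V E q x0 = K'"
    unfolding heat_kernel_def
  proof (rule the_equality)
    show "bounded_heat_solution V E q x0 K' \<and> (\<forall>t x. t < 0 \<or> x \<notin> V \<longrightarrow> K' t x = 0)"
      using sol by (simp add: K'_def)
    fix L
    assume L: "bounded_heat_solution V E q x0 L \<and> (\<forall>t x. t < 0 \<or> x \<notin> V \<longrightarrow> L t x = 0)"
    show "L = K'"
    proof (intro ext)
      fix t x
      show "L t x = K' t x"
        using bounded_heat_solution_unique[of x0 L K' t x] L sol
        by (cases "t < 0 \<or> x \<notin> V") (auto simp: K'_def)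
    qed
  qed
  then show ?thesis using assms(2,3) by (simp add: K'_def)
qed

end

section \<open>Walks in the tree and the heat kernel\<close>

text \<open>
  The number of walks of length \<open>n\<close> from a vertex at distance \<open>r\<close> to the base vertex, counted by
  their first step.
\<close>

fun tree_walks :: "nat \<Rightarrow> nat \<Rightarrow> nat \<Rightarrow> real" where
  "tree_walks q 0 r = (if r = 0 then 1 else 0)"
| "tree_walks q (Suc n) 0 = (real q + 1) * tree_walks q n 1"
| "tree_walks q (Suc n) (Suc r) = tree_walks q n r + real q * tree_walks q n (r + 2)"

lemma tree_walks_nonneg: "0 \<le> tree_walks q n r"
  by (induction q n r rule: tree_walks.induct) auto

text \<open>
  This bound is what the factor \<open>e\<^sup>-\<^sup>(\<^sup>q\<^sup>+\<^sup>1\<^sup>)\<^sup>t\<close> compensates: it makes the solution bounded by \<open>1\<close>.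
\<close>

lemma tree_walks_le: "tree_walks q n r \<le> (real q + 1) ^ n"
proof (induction q n r rule: tree_walks.induct)
  case (2 q n)
  then show ?case by (simp add: mult_left_mono)
next
  case (3 q n r)
  have "real q * tree_walks q n (r + 2) \<le> real q * (real q + 1) ^ n"
    using 3 by (intro mult_left_mono) auto
  then show ?case using 3 by (simp add: algebra_simps)
qed auto

lemma tree_walks_eq_0: "n < r \<Longrightarrow> tree_walks q n r = 0"
  by (induction q n r rule: tree_walks.induct) auto

definition walk_series :: "nat \<Rightarrow> nat \<Rightarrow> real \<Rightarrow> real" where
  "walk_series q r t = (\<Sum>n. tree_walks q n r / fact n * t ^ n)"

lemma walk_term_le:
  "\<bar>tree_walks q n r / fact n * t ^ n\<bar> \<le> ((real q + 1) * \<bar>t\<bar>) ^ n / fact n"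
  using tree_walks_nonneg[of q n r] tree_walks_le[of q n r]
  by (simp add: abs_mult power_mult_distrib power_abs divide_simps mult_right_mono)

lemma summable_walk_series: "summable (\<lambda>n. tree_walks q n r / fact n * t ^ n)"
  by (rule summable_comparison_test'[OF summable_exp_real, where N=0])
     (use walk_term_le in simp)

lemma abs_walk_series_le: "\<bar>walk_series q r t\<bar> \<le> exp ((real q + 1) * \<bar>t\<bar>)"
  using norm_suminf_le[OF walk_term_le[of q _ r t, folded real_norm_def] summable_exp_real]
  by (simp add: walk_series_def suminf_exp_real)

lemma walk_series_has_derivative:
  "(walk_series q r has_real_derivative (\<Sum>n. tree_walks q (Suc n) r / fact n * t ^ n)) (at t)"
proof -
  have "diffs (\<lambda>n. tree_walks q n r / fact n) = (\<lambda>n. tree_walks q (Suc n) r / fact n)"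
    by (simp add: diffs_def fun_eq_iff field_simps del: of_nat_Suc tree_walks.simps)
  then show ?thesis
    using termdiffs_strong_converges_everywhere[OF summable_walk_series, of q r t]
    by (simp add: walk_series_def[abs_def])
qed

lemma walk_series_deriv_0:
  "(walk_series q 0 has_real_derivative (real q + 1) * walk_series q 1 t) (at t)"
proof -
  have "(\<Sum>n. tree_walks q (Suc n) 0 / fact n * t ^ n) = (real q + 1) * walk_series q 1 t"
    unfolding walk_series_def
    by (subst suminf_mult[symmetric, OF summable_walk_series]) (simp add: mult_ac)
  then show ?thesis using walk_series_has_derivative[of q 0 t] by simp
qed

lemma walk_series_deriv_Suc:
  "(walk_series q (Suc r) has_real_derivative
     walk_series q r t + real q * walk_series q (r + 2) t) (at t)"
proof -
  have "(\<lambda>n. tree_walks q n r / fact n * t ^ n + real q * (tree_walks q n (r + 2) / fact n * t ^ n))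
      sums (walk_series q r t + real q * walk_series q (r + 2) t)"
    unfolding walk_series_def
    by (intro sums_add sums_mult summable_sums summable_walk_series)
  then have "(\<Sum>n. tree_walks q (Suc n) (Suc r) / fact n * t ^ n) =
      walk_series q r t + real q * walk_series q (r + 2) t"
    by (simp add: sums_iff algebra_simps add_divide_distrib)
  then show ?thesis using walk_series_has_derivative[of q "Suc r" t] by simp
qed

lemma walk_series_0: "walk_series q r 0 = (if r = 0 then 1 else 0)"
  using powser_zero[of "\<lambda>n. tree_walks q n r / fact n"] by (simp add: walk_series_def)

lemma (in regular_tree) bounded_heat_solution_walk_series:
  assumes x0: "x0 \<in> V"
  shows "bounded_heat_solution V E q x0
    (\<lambda>t x. exp (- (real q + 1) * t) * walk_series q (graph_dist E x0 x) t)"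
  unfolding bounded_heat_solution_def
proof (intro conjI)
  let ?e = "\<lambda>t. exp (- (real q + 1) * t)" and ?d = "graph_dist E x0"
  show "\<exists>C. \<forall>t\<ge>0. \<forall>x\<in>V. \<bar>?e t * walk_series q (?d x) t\<bar> \<le> C"
  proof (intro exI[of _ 1] allI impI ballI)
    fix t :: real and x
    assume "t \<ge> 0"
    have "\<bar>?e t * walk_series q (?d x) t\<bar> \<le> ?e t * exp ((real q + 1) * \<bar>t\<bar>)"
      by (simp add: abs_mult abs_walk_series_le del: mult_minus_left)
    also have "\<dots> = 1"
      using \<open>t \<ge> 0\<close> by (simp add: mult_exp_exp algebra_simps)
    finally show "\<bar>?e t * walk_series q (?d x) t\<bar> \<le> 1" .
  qed
  show "\<forall>x\<in>V. ?e 0 * walk_series q (?d x) 0 = (if x = x0 then 1 else 0)"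
    using graph_dist_eq_0_iff[OF x0] by (auto simp: walk_series_0)
  show "\<forall>t\<ge>0. \<forall>x\<in>V. \<exists>D. ((\<lambda>s. ?e s * walk_series q (?d x) s) has_real_derivative D)
      (at t within {0..}) \<and> laplacian V E q (\<lambda>x. ?e t * walk_series q (?d x) t) x + D = 0"
  proof (intro allI impI ballI)
    fix t :: real and x
    assume x: "x \<in> V"
    let ?S = "\<Sum>y\<in>neighbours V E x. walk_series q (?d y) t"
    have "(walk_series q (?d x) has_real_derivative ?S) (at t)"
    proof (cases "?d x")
      case 0
      then have "x = x0" using graph_dist_eq_0_iff[OF x0 x] by simp
      then show ?thesis
        using walk_series_deriv_0[of q t] 0 sum_neighbours_base[OF x0, of "\<lambda>r. walk_series q r t"]
        by simp
    next
      case (Suc n)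
      then show ?thesis
        using walk_series_deriv_Suc[of q n t] sum_neighbours_Suc[OF x0 x Suc, of "\<lambda>r. walk_series q r t"]
        by simp
    qed
    then have h: "(walk_series q (?d x) has_real_derivative ?S) (at t within {0..})"
      by (rule has_field_derivative_at_within)
    have e: "(?e has_real_derivative - (real q + 1) * ?e t) (at t within {0..})"
      by (rule derivative_eq_intros refl | simp)+
    have "((\<lambda>s. ?e s * walk_series q (?d x) s) has_real_derivative
        - (real q + 1) * ?e t * walk_series q (?d x) t + ?S * ?e t) (at t within {0..})"
      using e h by (rule DERIV_mult)
    moreover have "laplacian V E q (\<lambda>x. ?e t * walk_series q (?d x) t) x +
        (- (real q + 1) * ?e t * walk_series q (?d x) t + ?S * ?e t) = 0"
      by (simp add: laplacian_def sum_distrib_left algebra_simps)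
    ultimately show "\<exists>D. ((\<lambda>s. ?e s * walk_series q (?d x) s) has_real_derivative D)
        (at t within {0..}) \<and> laplacian V E q (\<lambda>x. ?e t * walk_series q (?d x) t) x + D = 0"
      by blast
  qed
qed

section \<open>Walks on the line and Bessel functions\<close>

text \<open>
  The total weight of the walks of length \<open>n\<close> from \<open>r\<close> to \<open>0\<close> on the integer line, where an upward
  step has weight \<open>q\<close> and a downward step weight \<open>1\<close>: if \<open>n = 2 k + r\<close>, then \<open>k\<close> steps go up.
\<close>

definition line_walks :: "nat \<Rightarrow> nat \<Rightarrow> nat \<Rightarrow> real" where
  "line_walks q n r =
     (if r \<le> n \<and> even (n - r)
      then real (n choose ((n - r) div 2)) * real q ^ ((n - r) div 2) else 0)"

lemma line_walks_eq: "line_walks q (2 * k + r) r = real ((2 * k + r) choose k) * real q ^ k"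
  by (simp add: line_walks_def)

lemma line_walks_eq_0:
  assumes "\<And>k. n \<noteq> 2 * k + r"
  shows "line_walks q n r = 0"
proof -
  have "\<not> (r \<le> n \<and> even (n - r))"
    using assms[of "(n - r) div 2"] by presburger
  then show ?thesis by (auto simp: line_walks_def)
qed

lemma line_walks_Suc_Suc:
  "line_walks q (Suc n) (Suc r) = line_walks q n r + real q * line_walks q n (r + 2)"
proof (cases "\<exists>k. n = 2 * k + r")
  case True
  then obtain k where k: "n = 2 * k + r" by blast
  have l: "line_walks q (Suc n) (Suc r) = real (Suc n choose k) * real q ^ k"
    using line_walks_eq[of q k "Suc r"] k by simp
  have m: "line_walks q n r = real (n choose k) * real q ^ k"
    using line_walks_eq[of q k r] k by simp
  show ?thesis
  proof (cases k)
    case 0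
    then show ?thesis using l m k by (simp add: line_walks_def)
  next
    case (Suc j)
    then have "line_walks q n (r + 2) = real (n choose j) * real q ^ j"
      using line_walks_eq[of q j "r + 2"] k by (simp add: add_ac)
    then show ?thesis using l m Suc by (simp add: algebra_simps)
  qed
next
  case False
  then have "line_walks q n r = 0"
    by (intro line_walks_eq_0) auto
  moreover have "line_walks q (Suc n) (Suc r) = 0"
    using False by (intro line_walks_eq_0) auto
  moreover have "line_walks q n (r + 2) = 0"
  proof (rule line_walks_eq_0)
    fix k
    show "n \<noteq> 2 * k + (r + 2)" using False by (auto dest: spec[of _ "Suc k"])
  qed
  ultimately show ?thesis by simp
qed

text \<open>
  The first step goes up with weight \<open>q\<close> or down to \<open>-1\<close>. Mirroring a walk from \<open>-1\<close> to \<open>0\<close> gives one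
  from \<open>1\<close> to \<open>0\<close> with one upward step fewer, so both cases contribute the same.
\<close>

lemma line_walks_Suc_0: "line_walks q (Suc n) 0 = 2 * real q * line_walks q n 1"
proof (cases "\<exists>k. n = 2 * k + 1")
  case True
  then obtain k where k: "n = 2 * k + 1" by blast
  have "line_walks q (Suc n) 0 = real (Suc n choose Suc k) * real q ^ Suc k"
    using line_walks_eq[of q "Suc k" 0] k by simp
  moreover have "Suc n choose Suc k = 2 * (n choose k)"
    using binomial_symmetric[of k n] k by simp
  moreover have "line_walks q n 1 = real (n choose k) * real q ^ k"
    using line_walks_eq[of q k 1] k by simp
  ultimately show ?thesis by simp
next
  case False
  then have "line_walks q n 1 = 0"
    by (intro line_walks_eq_0) auto
  moreover have "line_walks q (Suc n) 0 = 0"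
  proof (rule line_walks_eq_0)
    fix k
    show "Suc n \<noteq> 2 * k + 0" using False by (cases k) auto
  qed
  ultimately show ?thesis by simp
qed

text \<open>
  Both sides obey \<open>D\<^sub>n\<^sub>+\<^sub>1(0) = q D\<^sub>n(1)\<close> and \<open>D\<^sub>n\<^sub>+\<^sub>1(r + 1) = D\<^sub>n(r) + q D\<^sub>n(r + 2)\<close> with the same
  initial values, the recursion for weighted line walks that stay at or above \<open>0\<close>. For the
  right-hand side this is the reflection principle: reflecting the part of a walk after its first
  visit to \<open>-1\<close> moves its end from \<open>0\<close> to \<open>-2\<close> and removes one upward step, that is, one factor \<open>q\<close>.
\<close>

lemma tree_walks_diff:
  "tree_walks q n r - tree_walks q n (r + 2) = line_walks q n r - real q * line_walks q n (r + 2)"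
proof (induction n arbitrary: r)
  case 0
  then show ?case by (simp add: line_walks_def)
next
  case (Suc n)
  show ?case
  proof (cases r)
    case 0
    have "tree_walks q (Suc n) 0 - tree_walks q (Suc n) (0 + 2) =
        real q * (tree_walks q n 1 - tree_walks q n (1 + 2))"
      by (simp add: numeral_eq_Suc algebra_simps)
    also have "\<dots> = real q * (line_walks q n 1 - real q * line_walks q n (1 + 2))"
      by (simp only: Suc.IH)
    also have "\<dots> = line_walks q (Suc n) 0 - real q * line_walks q (Suc n) (0 + 2)"
      using line_walks_Suc_Suc[of q n 1] line_walks_Suc_0[of q n]
      by (simp add: numeral_eq_Suc algebra_simps)
    finally show ?thesis using 0 by simp
  next
    case (Suc m)
    have "tree_walks q (Suc n) (Suc m) - tree_walks q (Suc n) (Suc (m + 2)) =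
        (tree_walks q n m - tree_walks q n (m + 2)) +
        real q * (tree_walks q n (m + 2) - tree_walks q n (m + 2 + 2))"
      by (simp add: algebra_simps)
    also have "\<dots> = (line_walks q n m - real q * line_walks q n (m + 2)) +
        real q * (line_walks q n (m + 2) - real q * line_walks q n (m + 2 + 2))"
      by (simp only: Suc.IH)
    also have "\<dots> = line_walks q (Suc n) (Suc m) - real q * line_walks q (Suc n) (Suc (m + 2))"
      by (simp add: line_walks_Suc_Suc algebra_simps)
    finally show ?thesis using Suc by simp
  qed
qed

definition line_series :: "nat \<Rightarrow> nat \<Rightarrow> real \<Rightarrow> real" where
  "line_series q m t = (\<Sum>k. real q ^ k * t ^ (2 * k + m) / (fact k * fact (k + m)))"

text \<open>
  The factor \<open>1 / m!\<close> is kept because the series will also be summed over its order \<open>m\<close>.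
\<close>

lemma line_term_le:
  "\<bar>real q ^ k * t ^ (2 * k + m) / (fact k * fact (k + m))\<bar>
     \<le> \<bar>t\<bar> ^ m / fact m * ((real q * t\<^sup>2) ^ k / fact k)"
proof -
  have "\<bar>real q ^ k * t ^ (2 * k + m) / (fact k * fact (k + m))\<bar> =
      (real q * t\<^sup>2) ^ k * \<bar>t\<bar> ^ m / (fact k * fact (k + m))"
    by (simp add: abs_mult power_abs power_add power_mult power_mult_distrib)
  also have "\<dots> \<le> (real q * t\<^sup>2) ^ k * \<bar>t\<bar> ^ m / (fact k * fact m)"
    by (intro divide_left_mono mult_left_mono mult_nonneg_nonneg fact_mono mult_pos_pos) auto
  finally show ?thesis by (simp add: field_simps)
qed

lemma summable_line_series:
  "summable (\<lambda>k. real q ^ k * t ^ (2 * k + m) / (fact k * fact (k + m)))"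
proof (rule summable_comparison_test'[where N=0])
  show "summable (\<lambda>k. \<bar>t\<bar> ^ m / fact m * ((real q * t\<^sup>2) ^ k / fact k))"
    by (intro summable_mult summable_exp_real)
qed (simp only: real_norm_def line_term_le)

lemma abs_line_series_le: "\<bar>line_series q m t\<bar> \<le> \<bar>t\<bar> ^ m / fact m * exp (real q * t\<^sup>2)"
proof -
  let ?x = "real q * t\<^sup>2"
  have "norm (line_series q m t) \<le> (\<Sum>k. \<bar>t\<bar> ^ m / fact m * (?x ^ k / fact k))"
    unfolding line_series_def
    by (intro norm_suminf_le summable_mult summable_exp_real)
       (simp only: real_norm_def line_term_le)
  also have "\<dots> = \<bar>t\<bar> ^ m / fact m * exp ?x"
    by (subst suminf_mult[OF summable_exp_real]) (simp add: suminf_exp_real)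
  finally show ?thesis by simp
qed

lemma line_series_sums: "(\<lambda>n. line_walks q n r / fact n * t ^ n) sums line_series q r t"
proof -
  have "strict_mono (\<lambda>k. 2 * k + r)"
    by (auto simp: strict_mono_def)
  then have "(\<lambda>k. line_walks q (2 * k + r) r / fact (2 * k + r) * t ^ (2 * k + r))
        sums line_series q r t \<longleftrightarrow>
      (\<lambda>n. line_walks q n r / fact n * t ^ n) sums line_series q r t"
  proof (rule sums_mono_reindex)
    fix n assume "n \<notin> range (\<lambda>k. 2 * k + r)"
    then have "line_walks q n r = 0"
      by (intro line_walks_eq_0) auto
    then show "line_walks q n r / fact n * t ^ n = 0" by simp
  qed
  moreover have "line_walks q (2 * k + r) r / fact (2 * k + r) * t ^ (2 * k + r) =
      real q ^ k * t ^ (2 * k + r) / (fact k * fact (k + r))" for k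
  proof -
    have "real ((2 * k + r) choose k) = fact (2 * k + r) / (fact k * fact (k + r))"
      using binomial_fact[of k "2 * k + r", where 'a=real] by (simp add: mult_2 add_ac)
    then show ?thesis by (simp only: line_walks_eq) simp
  qed
  ultimately show ?thesis
    using summable_sums[OF summable_line_series] by (simp add: line_series_def)
qed

lemma walk_series_diff:
  "walk_series q r t - walk_series q (r + 2) t = line_series q r t - real q * line_series q (r + 2) t"
proof -
  have 1: "(\<lambda>n. tree_walks q n r / fact n * t ^ n - tree_walks q n (r + 2) / fact n * t ^ n)
      sums (walk_series q r t - walk_series q (r + 2) t)"
    unfolding walk_series_def
    by (intro sums_diff summable_sums summable_walk_series)
  have 2: "(\<lambda>n. line_walks q n r / fact n * t ^ n - real q * (line_walks q n (r + 2) / fact n * t ^ n))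
      sums (line_series q r t - real q * line_series q (r + 2) t)"
    by (intro sums_diff sums_mult line_series_sums)
  have "tree_walks q n r / fact n * t ^ n - tree_walks q n (r + 2) / fact n * t ^ n =
      line_walks q n r / fact n * t ^ n - real q * (line_walks q n (r + 2) / fact n * t ^ n)" for n
    using arg_cong[OF tree_walks_diff[of q n r], of "\<lambda>a. a / fact n * t ^ n"]
    by (simp add: algebra_simps diff_divide_distrib)
  with 1 have "(\<lambda>n. line_walks q n r / fact n * t ^ n - real q * (line_walks q n (r + 2) / fact n * t ^ n))
      sums (walk_series q r t - walk_series q (r + 2) t)" by (simp only:)
  then show ?thesis using 2 by (rule sums_unique2)
qed

text \<open>
  A walk between vertices at distance \<open>r\<close> has length at least \<open>r\<close>, so only the tail of an
  exponential series remains. This disposes of the boundary term of the telescoping sum.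
\<close>

lemma walk_series_tendsto_0: "(\<lambda>r. walk_series q r t) \<longlonglongrightarrow> 0"
proof (rule Lim_null_comparison)
  let ?a = "\<lambda>n. ((real q + 1) * \<bar>t\<bar>) ^ n / fact n"
  show "(\<lambda>r. \<Sum>n. ?a (n + r)) \<longlonglongrightarrow> 0"
    using suminf_exist_split2[OF summable_exp_real] by simp
  show "\<forall>\<^sub>F r in sequentially. norm (walk_series q r t) \<le> (\<Sum>n. ?a (n + r))"
  proof (intro always_eventually allI)
    fix r
    have "walk_series q r t = (\<Sum>n. tree_walks q (n + r) r / fact (n + r) * t ^ (n + r))"
      using suminf_split_initial_segment[OF summable_walk_series, of q r t r]
      by (simp add: walk_series_def tree_walks_eq_0)
    also have "norm \<dots> \<le> (\<Sum>n. ?a (n + r))"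
      by (rule norm_suminf_le)
        (use walk_term_le summable_ignore_initial_segment[OF summable_exp_real] in auto)
    finally show "norm (walk_series q r t) \<le> (\<Sum>n. ?a (n + r))" .
  qed
qed

lemma summable_line_series_orders: "summable (\<lambda>j. line_series q (r + 2 * j) t)"
proof (rule summable_comparison_test'[where N=0])
  have "inj (\<lambda>j::nat. r + 2 * j)" by (auto simp: inj_def)
  from summable_reindex[OF summable_exp_real[of "\<bar>t\<bar>"] this]
  have "summable (\<lambda>j. \<bar>t\<bar> ^ (r + 2 * j) / fact (r + 2 * j))"
    by (simp add: comp_def)
  then show "summable (\<lambda>j. \<bar>t\<bar> ^ (r + 2 * j) / fact (r + 2 * j) * exp (real q * t\<^sup>2))"
    by (rule summable_mult2)
qed (use abs_line_series_le in simp)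

lemma walk_series_eq:
  "walk_series q r t = line_series q r t - (real q - 1) * (\<Sum>j. line_series q (r + 2 * Suc j) t)"
proof -
  let ?g = "\<lambda>j. line_series q (r + 2 * j) t" and ?h = "\<lambda>j. walk_series q (r + 2 * j) t"
  have "strict_mono (\<lambda>j::nat. r + 2 * j)" by (auto simp: strict_mono_def)
  then have "?h \<longlonglongrightarrow> 0"
    using LIMSEQ_subseq_LIMSEQ[OF walk_series_tendsto_0] by (simp add: comp_def)
  from telescope_sums'[OF this] have "(\<lambda>j. ?h j - ?h (Suc j)) sums walk_series q r t"
    by simp
  moreover have "?h j - ?h (Suc j) = ?g j - real q * ?g (Suc j)" for j
    using walk_series_diff[of q "r + 2 * j" t] by (simp add: add_ac)
  ultimately have h: "(\<lambda>j. ?g j - real q * ?g (Suc j)) sums walk_series q r t"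
    by (simp only:)
  have s: "summable ?g" by (rule summable_line_series_orders)
  then have s': "summable (\<lambda>j. ?g (Suc j))" by (subst summable_Suc_iff)
  have "(\<lambda>j. ?g j - real q * ?g (Suc j)) sums (suminf ?g - real q * (\<Sum>j. ?g (Suc j)))"
    by (intro sums_diff sums_mult summable_sums s s')
  with h have "walk_series q r t = suminf ?g - real q * (\<Sum>j. ?g (Suc j))"
    by (rule sums_unique2)
  also have "suminf ?g = ?g 0 + (\<Sum>j. ?g (Suc j))"
    using suminf_split_head[OF s] by simp
  finally show ?thesis by (simp add: algebra_simps)
qed

text \<open>
  The powers of \<open>\<surd>q\<close> combine: \<open>(\<surd>q)\<^sup>m\<close> cancels the prefactor and \<open>(\<surd>q)\<^sup>2\<^sup>k\<close> becomes \<open>q\<^sup>k\<close>.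
\<close>

lemma line_series_eq_bessel:
  assumes "q > 0"
  shows "real q powr (- (real m / 2)) * bessel_I m (2 * sqrt (real q) * t) = line_series q m t"
proof -
  define c where "c = real q powr (- (real m / 2))"
  have "sqrt (real q) ^ m = real q powr (real m / 2)"
    using assms by (simp add: powr_half_sqrt[symmetric] powr_powr powr_realpow[symmetric])
  then have c: "c * sqrt (real q) ^ m = 1"
    using assms by (simp add: c_def powr_add[symmetric])
  then have c0: "c \<noteq> 0" by auto
  let ?f = "\<lambda>k. (2 * sqrt (real q) * t / 2) ^ (2 * k + m) / (fact k * Gamma (real (k + 1 + m)))"
  have termwise: "c * ?f k = real q ^ k * t ^ (2 * k + m) / (fact k * fact (k + m))" for k
  proof -
    have "Gamma (real (k + 1 + m)) = fact (k + m)"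
      using Gamma_fact[of "k + m", where 'a=real] by (simp add: add_ac)
    moreover have "(2 * sqrt (real q) * t / 2) ^ (2 * k + m) =
        sqrt (real q) ^ m * (real q ^ k * t ^ (2 * k + m))"
      by (simp add: power_mult_distrib power_add power_mult)
    ultimately have "c * ?f k =
        (c * sqrt (real q) ^ m) * (real q ^ k * t ^ (2 * k + m)) / (fact k * fact (k + m))"
      by simp
    then show ?thesis by (simp add: c)
  qed
  then have "summable (\<lambda>k. c * ?f k)" using summable_line_series[of q t m] by simp
  then have "summable ?f" using c0 by (simp only: summable_cmult_iff) simp
  then have "c * suminf ?f = (\<Sum>k. c * ?f k)" by (rule suminf_mult[symmetric])
  also have "\<dots> = line_series q m t" unfolding termwise line_series_def ..
  finally show ?thesis unfolding bessel_I_def c_def .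
qed

section \<open>The heat kernel formula\<close>

theorem proposition3p1:
  fixes V :: "'a set" and E :: "'a \<Rightarrow> 'a \<Rightarrow> bool"
    and q r :: nat and x0 x :: 'a and t :: real
  assumes "q > 0"
    and "regular_tree V E q"
    and "x0 \<in> V" and "x \<in> V"
    and "graph_dist E x0 x = r"
    and "t \<ge> 0"
  shows "summable (\<lambda>j. real q powr (- (real (r + 2 * Suc j) / 2)) * exp (- (real q + 1) * t)
             * bessel_I (r + 2 * Suc j) (2 * sqrt (real q) * t)) \<and>
         heat_kernel V E q x0 t x =
           real q powr (- (real r / 2)) * exp (- (real q + 1) * t)
             * bessel_I r (2 * sqrt (real q) * t)
           - (real q - 1) *
             (\<Sum>j. real q powr (- (real (r + 2 * Suc j) / 2)) * exp (- (real q + 1) * t)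
                    * bessel_I (r + 2 * Suc j) (2 * sqrt (real q) * t))"
proof -
  interpret regular_tree V E q by (rule assms(2))
  let ?e = "exp (- (real q + 1) * t)"
  have b: "real q powr (- (real m / 2)) * ?e * bessel_I m (2 * sqrt (real q) * t) =
      ?e * line_series q m t" for m
    using line_series_eq_bessel[OF assms(1), of m t] by (metis mult.assoc mult.commute)
  have s: "summable (\<lambda>j. line_series q (r + 2 * Suc j) t)"
    using summable_line_series_orders[of q "r + 2" t] by (simp add: add_ac)
  have "heat_kernel V E q x0 t x = ?e * walk_series q r t"
    using heat_kernel_eqI[OF bounded_heat_solution_walk_series[OF assms(3)] assms(6,4)] assms(5)
    by simp
  also have "\<dots> = ?e * line_series q r t
      - (real q - 1) * (?e * (\<Sum>j. line_series q (r + 2 * Suc j) t))"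
    by (simp add: walk_series_eq algebra_simps)
  also have "?e * (\<Sum>j. line_series q (r + 2 * Suc j) t) =
      (\<Sum>j. ?e * line_series q (r + 2 * Suc j) t)"
    by (rule suminf_mult[OF s, symmetric])
  finally show ?thesis
    unfolding b using summable_mult[OF s] by blast
qed

end
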